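(* Let $f:[0,1]\to[0,1]$, $\theta:[0,\infty)\to[0,\infty)$ and $r:[0,\infty)\to\mathbb{R}$ be continuous functions, and let $x:[0,\infty)\to[0,1]$ be a continuously differentiable function satisfying $$x'(t)+\theta(t)x(t)=\theta(t)f(x(t))+r(t)\qquad\text{for all } t\ge 0 .$$ Assume that (1) $\theta(t)\neq 0$ for all sufficiently large $t$, and $\lim_{t\to\infty}\frac{r(t)}{\theta(t)}=0$; (2) the integral $\int_0^\infty\theta(t)\,dt$ diverges; (3) the integral $\int_0^\infty r(t)\,dt$ converges. Then $x(t)$ converges to a fixed point of $f$ as $t\to\infty$, i.e. there is $x_\infty\in[0,1]$ with $f(x_\infty)=x_\infty$ and $\lim_{t\to\infty}x(t)=x_\infty$.
   Context: Integrals over $[0,\infty)$ are improper integrals: $\int_0^\infty r(t)\,dt$ converges means that $\lim_{T\to\infty}\int_0^T r(t)\,dt$ exists in $\mathbb{R}$ (not necessarily absolute convergence). At $t=0$ the derivative is one-sided. *)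

theory Defs
  imports "HOL-Analysis.Analysis"
begin

text \<open>
  Improper, not necessarily absolute, convergence. The integrability conjunct (automatic for
  continuous integrands) excludes the default value 0 that \<^term>\<open>integral\<close> takes
  on non-integrable functions.
\<close>

definition improper_integral_converges :: "(real \<Rightarrow> real) \<Rightarrow> bool" where
  "improper_integral_converges g \<longleftrightarrow>
     (\<forall>T\<ge>0. g integrable_on {0..T}) \<and>
     (\<exists>L. ((\<lambda>T. integral {0..T} g) \<longlongrightarrow> L) at_top)"

end

theory Submission
  imports Defs
begin

text \<open>
  Put \<open>h u = f u - u\<close>, so that \<open>x' = \<theta> (h (x) + r / \<theta>)\<close>. If \<open>h c \<noteq> 0\<close>, then at late times \<open>x\<close> can
  cross the level \<open>c\<close> in one direction only. Hence, if \<open>x\<close> oscillated between \<open>p\<close> and \<open>q > p\<close>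
  forever, \<open>h\<close> would vanish on \<open>[p, q]\<close>, each upcrossing of \<open>[p, q]\<close> would follow \<open>x' = r\<close>, and the
  increment \<open>q - p\<close> would be bounded by an integral of \<open>r\<close> over a late interval, which is small. So
  \<open>x\<close> converges; if \<open>h\<close> did not vanish at the limit, \<open>\<bar>x'\<bar>\<close> would eventually dominate a multiple of
  \<open>\<theta>\<close>, and the integral of \<open>\<theta>\<close> would be finite.
\<close>

section \<open>Convergence of bounded functions that do not oscillate\<close>

lemma tendsto_at_top_if_no_oscillation:
  fixes x :: "real \<Rightarrow> real"
  assumes lower: "\<forall>\<^sub>F t in at_top. a \<le> x t"
    and upper: "\<forall>\<^sub>F t in at_top. x t \<le> b"
    and no_osc: "\<And>p q. p < q \<Longrightarrow> (\<forall>\<^sub>F t in at_top. p \<le> x t) \<or> (\<forall>\<^sub>F t in at_top. x t \<le> q)"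
  shows "\<exists>L. (x \<longlongrightarrow> L) at_top"
proof -
  \<comment> \<open>The supremum of the eventual lower bounds is the limit inferior of
    \<open>x\<close>. A level above it is not an eventual lower bound, so by \<open>no_osc\<close>
    every still higher level is an eventual upper bound.\<close>
  define S where "S = {c. \<forall>\<^sub>F t in at_top. c \<le> x t}"
  have "a \<in> S" using lower by (simp add: S_def)
  have le_b: "c \<le> b" if "c \<in> S" for c
  proof -
    have "\<forall>\<^sub>F t in at_top. c \<le> x t" using that by (simp add: S_def)
    then have "\<forall>\<^sub>F t in at_top :: real filter. c \<le> b"
      using upper by eventually_elim simp
    then show ?thesis by simp
  qed
  then have bdd: "bdd_above S" by (auto simp: bdd_above_def)
  have "(x \<longlongrightarrow> Sup S) at_top"
  proof (rule order_tendstoI)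
    fix y assume "y < Sup S"
    then obtain c where c: "c \<in> S" "y < c"
      using less_cSupE[of y S] \<open>a \<in> S\<close> by blast
    then have "\<forall>\<^sub>F t in at_top. c \<le> x t" by (simp add: S_def)
    then show "\<forall>\<^sub>F t in at_top. y < x t" by eventually_elim (use c in simp)
  next
    fix y assume y: "Sup S < y"
    \<comment> \<open>Two intermediate levels are needed: \<open>p\<close> strictly above
      \<open>Sup S\<close> to fall outside \<open>S\<close>, and \<open>q\<close> strictly below
      \<open>y\<close> to give a strict bound.\<close>
    define p where "p = (2 * Sup S + y) / 3"
    define q where "q = (Sup S + 2 * y) / 3"
    have pq: "Sup S < p" "p < q" "q < y" using y by (simp_all add: p_def q_def)
    then have "p \<notin> S" using cSup_upper[OF _ bdd, of p] by force
    then have "\<forall>\<^sub>F t in at_top. x t \<le> q"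
      using no_osc[OF pq(2)] by (simp add: S_def)
    then show "\<forall>\<^sub>F t in at_top. x t < y" by eventually_elim (use pq in simp)
  qed
  then show ?thesis ..
qed

section \<open>Crossings of levels and bands\<close>

lemma level_not_crossed_downwards:
  fixes x x' :: "real \<Rightarrow> real"
  assumes deriv: "\<And>t. T \<le> t \<Longrightarrow> (x has_real_derivative x' t) (at t)"
    and pos: "\<And>t. T \<le> t \<Longrightarrow> x t = c \<Longrightarrow> 0 < x' t"
    and "T \<le> s" "s \<le> t" "c \<le> x s"
  shows "c \<le> x t"
proof (rule ccontr)
  assume "\<not> c \<le> x t"
  then have xt: "x t < c" by simp
  have cont: "continuous_on {u..v} x" if "T \<le> u" for u v
    by (rule DERIV_continuous_on, rule has_field_derivative_at_within, rule deriv) (use that in simp)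
  \<comment> \<open>At the last time \<open>w\<close> at which \<open>x\<close> equals
    \<open>c\<close>, the positive derivative lifts \<open>x\<close> above \<open>c\<close>. Since
    \<open>x t < c\<close>, the level must be met again after \<open>w\<close>, a
    contradiction.\<close>
  define K where "K = {u \<in> {s..t}. x u = c}"
  have "K = {s..t} \<inter> x -` {c}" by (auto simp: K_def)
  then have "compact K"
    using continuous_closed_preimage[OF cont[OF \<open>T \<le> s\<close>], of t "{c}"]
    by (simp add: compact_eq_bounded_closed bounded_Int)
  moreover obtain z where "s \<le> z" "z \<le> t" "x z = c"
    using IVT2'[OF less_imp_le[OF xt] \<open>c \<le> x s\<close> \<open>s \<le> t\<close> cont[OF \<open>T \<le> s\<close>]] by blast
  then have "K \<noteq> {}" by (auto simp: K_def)
  ultimately obtain w where w: "w \<in> K" and max: "\<And>u. u \<in> K \<Longrightarrow> u \<le> w"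
    using compact_attains_sup[of K] by blast
  have "s \<le> w" "w < t" "x w = c" using w xt by (auto simp: K_def less_le)
  obtain d where "0 < d" and inc: "\<And>h. 0 < h \<Longrightarrow> h < d \<Longrightarrow> x w < x (w + h)"
    using DERIV_pos_inc_right[OF deriv[of w] pos[of w]] \<open>s \<le> w\<close> \<open>T \<le> s\<close> \<open>x w = c\<close> by auto
  \<comment> \<open>Halving \<open>d\<close> keeps the increment strictly below \<open>d\<close>;
    the minimum keeps \<open>y\<close> from passing \<open>t\<close>.\<close>
  define y where "y = w + min (d / 2) (t - w)"
  have y: "w < y" "y \<le> t" "c < x y"
    using inc[of "min (d / 2) (t - w)"] \<open>0 < d\<close> \<open>w < t\<close> \<open>x w = c\<close> by (auto simp: y_def)
  obtain u where "y \<le> u" "u \<le> t" "x u = c"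
    using IVT2'[of x t c y] xt y cont[of y t] \<open>s \<le> w\<close> \<open>T \<le> s\<close> by auto
  then have "u \<in> K" using y \<open>s \<le> w\<close> by (auto simp: K_def)
  then show False using max[of u] y \<open>y \<le> u\<close> by simp
qed

lemma eventually_one_side_of_level:
  fixes x x' :: "real \<Rightarrow> real"
  assumes "\<And>t. T \<le> t \<Longrightarrow> (x has_real_derivative x' t) (at t)"
    and "\<And>t. T \<le> t \<Longrightarrow> x t = c \<Longrightarrow> 0 < x' t"
  shows "(\<forall>\<^sub>F t in at_top. c \<le> x t) \<or> (\<forall>\<^sub>F t in at_top. x t \<le> c)"
proof (cases "\<exists>s\<ge>T. c \<le> x s")
  case True
  then obtain s where "T \<le> s" "c \<le> x s" by blast
  then have "c \<le> x t" if "s \<le> t" for t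
    using level_not_crossed_downwards[of T x x' c s t] assms that by blast
  then have "\<forall>\<^sub>F t in at_top. c \<le> x t"
    by (rule eventually_at_top_linorderI)
  then show ?thesis ..
next
  case False
  then have "\<forall>\<^sub>F t in at_top. x t \<le> c"
    by (intro eventually_at_top_linorderI[of T]) force
  then show ?thesis ..
qed

text \<open>Take \<open>v\<close> as the first time with \<open>q \<le> x v\<close>, then
  \<open>u\<close> as the last time before \<open>v\<close> with \<open>x u \<le> p\<close>. Both
  exist by compactness, and strictly between them both inequalities must fail.\<close>

lemma upcrossing:
  fixes x :: "real \<Rightarrow> real"
  assumes cont: "continuous_on {s..t} x"
    and "s \<le> t" "x s < p" "p < q" "q < x t"
  obtains u v where "s \<le> u" "u < v" "v \<le> t" "x u \<le> p" "q \<le> x v"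
    "\<And>w. u < w \<Longrightarrow> w < v \<Longrightarrow> p < x w \<and> x w < q"
proof -
  define V where "V = {w \<in> {s..t}. q \<le> x w}"
  have "V = {s..t} \<inter> x -` {q..}" by (auto simp: V_def)
  then have "compact V"
    using continuous_closed_preimage[OF cont, of "{q..}"] by (simp add: compact_eq_bounded_closed bounded_Int)
  moreover have "t \<in> V" using assms by (simp add: V_def)
  ultimately obtain v where v: "v \<in> V" and vmin: "\<And>w. w \<in> V \<Longrightarrow> v \<le> w"
    using compact_attains_inf[of V] by blast
  have sv: "s \<le> v" "v \<le> t" "q \<le> x v" using v by (auto simp: V_def)
  define U where "U = {w \<in> {s..v}. x w \<le> p}"
  have "U = {s..v} \<inter> x -` {..p}" by (auto simp: U_def)
  moreover have "continuous_on {s..v} x" by (rule continuous_on_subset[OF cont]) (use sv in auto)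
  ultimately have "compact U"
    using continuous_closed_preimage[of "{s..v}" x "{..p}"] by (simp add: compact_eq_bounded_closed bounded_Int)
  moreover have "s \<in> U" using assms sv by (simp add: U_def)
  ultimately obtain u where u: "u \<in> U" and umax: "\<And>w. w \<in> U \<Longrightarrow> w \<le> u"
    using compact_attains_sup[of U] by blast
  have su: "s \<le> u" "u \<le> v" "x u \<le> p" using u by (auto simp: U_def)
  show ?thesis
  proof (rule that[of u v])
    show "u < v" using su sv \<open>p < q\<close> by (cases "u = v") auto
    fix w assume w: "u < w" "w < v"
    then have "w \<notin> U" "w \<notin> V" using umax[of w] vmin[of w] by auto
    then show "p < x w \<and> x w < q" using w su sv by (auto simp: U_def V_def)
  qed (use su sv in auto)
qed

section \<open>Integrals from 0 and their convergence\<close>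

lemma has_real_derivative_integral_from_0:
  fixes g :: "real \<Rightarrow> real"
  assumes "continuous_on {0..} g" "0 < t"
  shows "((\<lambda>T. integral {0..T} g) has_real_derivative g t) (at t)"
proof -
  have "((\<lambda>T. integral {0..T} g) has_real_derivative g t) (at t within {0..t + 1})"
    by (rule integral_has_real_derivative) (use assms in \<open>auto intro: continuous_on_subset\<close>)
  then show ?thesis
    using assms(2) at_within_interior[of t "{0..t + 1}"] by simp
qed

text \<open>The integral is nondecreasing in its upper end, so once it reaches a level it stays
  above it and cannot oscillate. Contrapositively, divergence of \<open>\<theta>\<close> means
  unbounded integrals.\<close>

lemma improper_integral_converges_if_bounded:
  fixes g :: "real \<Rightarrow> real"
  assumes cont: "continuous_on {0..} g"
    and nonneg: "g \<in> {0..} \<rightarrow> {0..}"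
    and bound: "\<forall>\<^sub>F t in at_top. integral {0..t} g \<le> B"
  shows "improper_integral_converges g"
proof -
  have int: "g integrable_on {0..T}" for T
    by (rule integrable_continuous_real) (rule continuous_on_subset[OF cont], auto)
  have mono: "integral {0..s} g \<le> integral {0..t} g" if "s \<le> t" for s t
    by (rule integral_subset_le) (use that nonneg int in auto)
  have ge_0: "0 \<le> integral {0..t} g" for t
    by (rule integral_nonneg) (use nonneg int in auto)
  have "\<exists>L. ((\<lambda>T. integral {0..T} g) \<longlongrightarrow> L) at_top"
  proof (rule tendsto_at_top_if_no_oscillation[of 0, OF _ bound])
    show "\<forall>\<^sub>F t in at_top. 0 \<le> integral {0..t} g" using ge_0 by simp
    fix p q :: real assume "p < q"
    show "(\<forall>\<^sub>F t in at_top. p \<le> integral {0..t} g) \<or> (\<forall>\<^sub>F t in at_top. integral {0..t} g \<le> q)"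
    proof (cases "\<exists>s. p \<le> integral {0..s} g")
      case True
      then obtain s where "p \<le> integral {0..s} g" ..
      then have "\<forall>\<^sub>F t in at_top. p \<le> integral {0..t} g"
        using mono by (intro eventually_at_top_linorderI[of s]) (rule order_trans)
      then show ?thesis ..
    next
      case False
      then have "integral {0..t} g \<le> q" for t
        using \<open>p < q\<close> by (simp add: not_le) (use less_trans less_imp_le in blast)
      then show ?thesis by simp
    qed
  qed
  then show ?thesis using int by (simp add: improper_integral_converges_def)
qed

theorem theorem1p4:
  fixes f \<theta> r x x' :: "real \<Rightarrow> real"
  assumes f_cont: "continuous_on {0..1} f"
    and f_range: "f \<in> {0..1} \<rightarrow> {0..1}"
    and \<theta>_cont: "continuous_on {0..} \<theta>"
    and \<theta>_range: "\<theta> \<in> {0..} \<rightarrow> {0..}"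
    and r_cont: "continuous_on {0..} r"
    and x_range: "x \<in> {0..} \<rightarrow> {0..1}"
    and x_deriv: "\<And>t. t \<ge> 0 \<Longrightarrow> (x has_real_derivative x' t) (at t within {0..})"
    and x'_cont: "continuous_on {0..} x'"
    and ode: "\<And>t. t \<ge> 0 \<Longrightarrow> x' t + \<theta> t * x t = \<theta> t * f (x t) + r t"
    and \<theta>_nonzero: "\<forall>\<^sub>F t in at_top. \<theta> t \<noteq> 0"
    and ratio_lim: "((\<lambda>t. r t / \<theta> t) \<longlongrightarrow> 0) at_top"
    and \<theta>_diverges: "\<not> improper_integral_converges \<theta>"
    and r_converges: "improper_integral_converges r"
  shows "\<exists>x_inf\<in>{0..1}. f x_inf = x_inf \<and> (x \<longlongrightarrow> x_inf) at_top"
proof -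
  define h where "h = (\<lambda>u. f u - u)"
  define R where "R = (\<lambda>t. integral {0..t} r)"
  have deriv: "(x has_real_derivative x' t) (at t)" if "0 < t" for t
    using x_deriv[of t] that at_within_interior[of t "{0..}"] by simp
  have x_cont: "continuous_on {0..} x"
    using x_deriv by (intro DERIV_continuous_on) auto
  have R_deriv: "(R has_real_derivative r t) (at t)" if "0 < t" for t
    unfolding R_def by (rule has_real_derivative_integral_from_0[OF r_cont that])
  have x01: "x t \<in> {0..1}" if "0 \<le> t" for t using x_range that by auto
  have ev_pos: "\<forall>\<^sub>F t in at_top. 0 < t \<and> 0 < \<theta> t"
    using \<theta>_nonzero eventually_gt_at_top[of 0]
    by eventually_elim (use \<theta>_range in \<open>force simp: Pi_iff less_le\<close>)
  \<comment> \<open>With \<open>\<theta>\<close> positive, the sign of \<open>x'\<close> is that of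
    the second factor.\<close>
  have ode': "x' t = \<theta> t * (h (x t) + r t / \<theta> t)" if "0 < t \<and> 0 < \<theta> t" for t
    using ode[of t] that by (simp add: h_def distrib_left right_diff_distrib)

  \<comment> \<open>Levels \<open>c\<close> with \<open>h c \<noteq> 0\<close>\<close>
  have one_side: "(\<forall>\<^sub>F t in at_top. c \<le> x t) \<or> (\<forall>\<^sub>F t in at_top. x t \<le> c)" if "h c \<noteq> 0" for c
  proof -
    \<comment> \<open>Under this bound the perturbation \<open>r t / \<theta> t\<close> cannot
      change the sign of \<open>h c\<close>.\<close>
    have "\<forall>\<^sub>F t in at_top. \<bar>r t / \<theta> t\<bar> < \<bar>h c\<bar>"
      using tendstoD[OF ratio_lim, of "\<bar>h c\<bar>"] that by (simp add: dist_real_def)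
    then have "\<forall>\<^sub>F t in at_top. (0 < t \<and> 0 < \<theta> t) \<and> \<bar>r t / \<theta> t\<bar> < \<bar>h c\<bar>"
      using ev_pos by eventually_elim simp
    then obtain T where T: "\<And>t. T \<le> t \<Longrightarrow> (0 < t \<and> 0 < \<theta> t) \<and> \<bar>r t / \<theta> t\<bar> < \<bar>h c\<bar>"
      by (auto simp: eventually_at_top_linorder)
    consider "0 < h c" | "h c < 0" using \<open>h c \<noteq> 0\<close> by linarith
    then show ?thesis
    proof cases
      case 1
      have "0 < x' t" if "T \<le> t" "x t = c" for t
      proof -
        have "0 < h (x t) + r t / \<theta> t" unfolding that(2) using T[OF that(1)] 1 by linarith
        then show ?thesis using ode'[of t] T[OF that(1)] by simp
      qed
      then show ?thesis using eventually_one_side_of_level[of T x x' c] T deriv by blast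
    next
      case 2
      \<comment> \<open>Reflecting \<open>x\<close> to its negative reduces this case to upward
        crossings.\<close>
      have "0 < - x' t" if "T \<le> t" "- x t = - c" for t
      proof -
        have "x t = c" using that(2) by simp
        have "h (x t) + r t / \<theta> t < 0" unfolding \<open>x t = c\<close> using T[OF that(1)] 2 by linarith
        then show ?thesis using ode'[of t] T[OF that(1)] by (simp add: mult_pos_neg)
      qed
      moreover have "((\<lambda>t. - x t) has_real_derivative - x' t) (at t)" if "T \<le> t" for t
        using T[OF that] deriv by (intro DERIV_minus) simp
      ultimately show ?thesis
        using eventually_one_side_of_level[of T "\<lambda>t. - x t" "\<lambda>t. - x' t" "- c"] by auto
    qed
  qed

  \<comment> \<open>Convergence of \<open>x\<close>\<close>
  have "\<exists>c. (x \<longlongrightarrow> c) at_top"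
  proof (rule tendsto_at_top_if_no_oscillation[of 0 _ 1])
    show "\<forall>\<^sub>F t in at_top. 0 \<le> x t" "\<forall>\<^sub>F t in at_top. x t \<le> 1"
      using x01 by (auto intro!: eventually_at_top_linorderI[of 0])
    fix p q :: real assume "p < q"
    show "(\<forall>\<^sub>F t in at_top. p \<le> x t) \<or> (\<forall>\<^sub>F t in at_top. x t \<le> q)"
    proof (rule ccontr)
      assume "\<not> ?thesis"
      then have freq: "\<exists>\<^sub>F t in at_top. x t < p" "\<exists>\<^sub>F t in at_top. q < x t"
        by (simp_all add: not_eventually not_le)
      \<comment> \<open>Both sides of such a \<open>c\<close> are visited at arbitrarily late times,
        which \<open>one_side\<close> forbids unless \<open>h c\<close> vanishes.\<close>
      have h0: "h c = 0" if "p < c" "c < q" for c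
      proof (rule ccontr)
        assume "h c \<noteq> 0"
        from one_side[OF this] show False
        proof
          assume "\<forall>\<^sub>F t in at_top. c \<le> x t"
          then have "\<forall>\<^sub>F t in at_top. \<not> x t < p" by eventually_elim (use that in simp)
          then show False using freq(1) by (simp add: frequently_def)
        next
          assume "\<forall>\<^sub>F t in at_top. x t \<le> c"
          then have "\<forall>\<^sub>F t in at_top. \<not> q < x t" by eventually_elim (use that in simp)
          then show False using freq(2) by (simp add: frequently_def)
        qed
      qed
      obtain L where L: "(R \<longlongrightarrow> L) at_top"
        using r_converges by (auto simp: improper_integral_converges_def R_def)
      \<comment> \<open>Half the gap, so that two late values of \<open>R\<close> differ by less
        than \<open>q - p\<close>.\<close>
      have "\<forall>\<^sub>F t in at_top. \<bar>R t - L\<bar> < (q - p) / 2"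
        using tendstoD[OF L, of "(q - p) / 2"] \<open>p < q\<close> by (simp add: dist_real_def)
      then have "\<forall>\<^sub>F t in at_top. 0 < t \<and> \<bar>R t - L\<bar> < (q - p) / 2"
        using eventually_gt_at_top[of 0] by eventually_elim simp
      then obtain T where T: "\<And>t. T \<le> t \<Longrightarrow> 0 < t \<and> \<bar>R t - L\<bar> < (q - p) / 2"
        by (auto simp: eventually_at_top_linorder)
      obtain s where s: "T \<le> s" "x s < p"
        using freq(1) by (auto simp: frequently_def eventually_at_top_linorder)
      obtain t where t: "s \<le> t" "q < x t"
        using freq(2) by (auto simp: frequently_def eventually_at_top_linorder)
      have "0 < s" using T[OF s(1)] by simp
      have "continuous_on {s..t} x"
        by (rule continuous_on_subset[OF x_cont]) (use \<open>0 < s\<close> in auto)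
      then obtain u v where uv: "s \<le> u" "u < v" "v \<le> t" "x u \<le> p" "q \<le> x v"
        and between: "\<And>w. u < w \<Longrightarrow> w < v \<Longrightarrow> p < x w \<and> x w < q"
        using upcrossing[OF _ t(1) s(2) \<open>p < q\<close> t(2)] by metis
      have D: "((\<lambda>w. x w - R w) has_real_derivative x' w - r w) (at w)" if "u \<le> w" for w
        using deriv[of w] R_deriv[of w] that uv \<open>0 < s\<close> by (intro DERIV_diff) auto
      \<comment> \<open>Inside the band the equation reduces to \<open>x' = r\<close>. Hence
        \<open>R\<close> grows from \<open>u\<close> to \<open>v\<close> by as much as
        \<open>x\<close>, that is by at least \<open>q - p\<close>.\<close>
      have "x v - R v = x u - R u"
      proof (rule DERIV_isconst_end[OF uv(2)])
        show "continuous_on {u..v} (\<lambda>w. x w - R w)"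
          by (rule DERIV_continuous_on) (use D in \<open>auto intro: has_field_derivative_at_within\<close>)
        fix w assume w: "u < w" "w < v"
        have "h (x w) = 0" using between[OF w] h0 by simp
        then have "x' w - r w = 0"
          using ode[of w] w uv \<open>0 < s\<close> by (simp add: h_def)
        then show "((\<lambda>w. x w - R w) has_real_derivative 0) (at w)"
          using D[of w] w by simp
      qed
      moreover have "\<bar>R u - L\<bar> < (q - p) / 2" "\<bar>R v - L\<bar> < (q - p) / 2"
        using T[of u] T[of v] s uv by auto
      ultimately show False using uv by (simp add: abs_if field_simps split: if_splits)
    qed
  qed
  then obtain c where c: "(x \<longlongrightarrow> c) at_top" ..
  have ev01: "\<forall>\<^sub>F t in at_top. x t \<in> {0..1}"
    using x01 by (auto intro!: eventually_at_top_linorderI[of 0])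
  have c01: "c \<in> {0..1}"
    by (rule Lim_in_closed_set[OF _ ev01 _ c]) auto

  \<comment> \<open>The limit is a fixed point\<close>
  have "h c = 0"
  proof (rule ccontr)
    assume "h c \<noteq> 0"
    \<comment> \<open>The factor \<open>\<sigma>\<close> treats both signs of \<open>h c\<close> at
      once: \<open>\<sigma> * (h (x t) + r t / \<theta> t)\<close> tends to
      \<open>\<bar>h c\<bar>\<close>, and so eventually exceeds half of it.\<close>
    define m where "m = \<bar>h c\<bar> / 2"
    define \<sigma> where "\<sigma> = sgn (h c)"
    have "0 < m" using \<open>h c \<noteq> 0\<close> by (simp add: m_def)
    have "((\<lambda>t. \<sigma> * (f (x t) - x t + r t / \<theta> t)) \<longlongrightarrow> \<sigma> * (f c - c + 0)) at_top"
      by (intro tendsto_intros continuous_on_tendsto_compose[OF f_cont c c01 ev01] c ratio_lim)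
    moreover have "\<sigma> * (f c - c + 0) = 2 * m"
      by (simp add: \<sigma>_def m_def h_def sgn_if)
    ultimately have "\<forall>\<^sub>F t in at_top. m < \<sigma> * (h (x t) + r t / \<theta> t)"
      using order_tendstoD(1)[of _ "2 * m" at_top m] \<open>0 < m\<close> by (simp add: h_def)
    then have "\<forall>\<^sub>F t in at_top. (0 < t \<and> 0 < \<theta> t) \<and> m < \<sigma> * (h (x t) + r t / \<theta> t)"
      using ev_pos by eventually_elim simp
    then obtain T where T: "\<And>t. T \<le> t \<Longrightarrow> (0 < t \<and> 0 < \<theta> t) \<and> m < \<sigma> * (h (x t) + r t / \<theta> t)"
      by (auto simp: eventually_at_top_linorder)
    have dom: "m * \<theta> t \<le> \<sigma> * x' t" if "T \<le> t" for t
    proof -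
      have "\<theta> t * m \<le> \<theta> t * (\<sigma> * (h (x t) + r t / \<theta> t))"
        using T[OF that] by (intro mult_left_mono) auto
      then show ?thesis using ode'[of t] T[OF that] by (simp add: mult_ac)
    qed
    \<comment> \<open>By \<open>dom\<close>, \<open>G\<close> is nondecreasing from \<open>T\<close>
      on. As \<open>\<sigma> * x t\<close> is at most 1, this bounds the integrals of
      \<open>\<theta>\<close> uniformly.\<close>
    define G where "G = (\<lambda>t. \<sigma> * x t - m * integral {0..t} \<theta>)"
    have G_mono: "G T \<le> G t" if "T \<le> t" for t
    proof (rule DERIV_nonneg_imp_nondecreasing[OF that])
      fix w assume "T \<le> w" "w \<le> t"
      then have "(G has_real_derivative \<sigma> * x' w - m * \<theta> w) (at w)"
        unfolding G_def using T[of w]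
        by (intro DERIV_diff DERIV_cmult deriv has_real_derivative_integral_from_0 \<theta>_cont) auto
      then show "\<exists>y. (G has_real_derivative y) (at w) \<and> 0 \<le> y"
        using dom[OF \<open>T \<le> w\<close>] by force
    qed
    have "integral {0..t} \<theta> \<le> (1 - G T) / m" if "T \<le> t" for t
    proof -
      have "\<sigma> * x t \<le> 1"
        using x01[of t] T[OF that] by (auto simp: \<sigma>_def sgn_if)
      then have "m * integral {0..t} \<theta> \<le> 1 - G T"
        using G_mono[OF that] by (simp add: G_def)
      then show ?thesis using \<open>0 < m\<close> by (simp add: field_simps)
    qed
    then have "improper_integral_converges \<theta>"
      by (intro improper_integral_converges_if_bounded[OF \<theta>_cont \<theta>_range] eventually_at_top_linorderI)
    then show False using \<theta>_diverges by simp
  qed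
  then show ?thesis using c c01 by (auto simp: h_def)
qed

end
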